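(* Let $\gamma_{\min}>1$ and $\gamma>\gamma_{\min}$. Then for any $R\ge2$ there is a sequence $(\varepsilon_n)$ with $\varepsilon_n\to0$ such that for all $n$, $$\sup_{f\in\mathcal{F}_n(R)}\frac{\mathbb{E}_f\big(\|\tilde f^H_{n,\gamma}-f\|_2^2\big)}{\sum_{\lambda\in\Gamma_n}\min(\beta_\lambda^2,V_{\lambda,n})+\frac1n}\ge 2(\sqrt\gamma-\sqrt{\gamma_{\min}})^2\ln n\,(1+\varepsilon_n),$$ where $\mathbb{E}_f$ denotes expectation when $N$ is a Poisson process on $\mathbb{R}$ with intensity $nf$ with respect to Lebesgue measure, and $\beta_\lambda,V_{\lambda,n}$ are computed from $f$.
   Context: Haar basis: $\phi=1_{[0,1]}$, $\psi=1_{[0,1/2]}-1_{(1/2,1]}$, $\phi_k(x)=\phi(x-k)$, $\psi_{j,k}(x)=2^{j/2}\psi(2^jx-k)$ ($j\ge0$, $k\in\mathbb{Z}$). $\Lambda=\{(j,k):j\ge-1,k\in\mathbb{Z}\}$; $\varphi_\lambda=\phi_k$ if $\lambda=(-1,k)$ and $\varphi_\lambda=\psi_{j,k}$ if $\lambda=(j,k)$, $j\ge0$. For $f\in L_2$, $\beta_\lambda=\int\varphi_\lambda f$; $F_\lambda=\int_{\{\varphi_\lambda\ne0\}}f$. $\mathcal{F}_n(R)$ ($n\ge2$, $R>0$): nonnegative $f$ with $\|f\|_1,\|f\|_2,\|f\|_\infty\le R$ and $F_\lambda\ge\frac{(\ln n)(\ln\ln n)}{n}1_{\{\beta_\lambda\ne0\}}$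 for all $\lambda\in\Lambda$. Define $\hat\beta_\lambda=\frac1n\sum_{T\in N}\varphi_\lambda(T)$, $\hat V_{\lambda,n}=\frac1{n^2}\sum_{T\in N}\varphi_\lambda^2(T)$, $V_{\lambda,n}=\frac1n\int\varphi_\lambda^2 f$, $$\tilde V_{\lambda,n}=\hat V_{\lambda,n}+\sqrt{2\gamma\ln n\,\hat V_{\lambda,n}\frac{\|\varphi_\lambda\|_\infty^2}{n^2}}+3\gamma\ln n\frac{\|\varphi_\lambda\|_\infty^2}{n^2},\qquad \eta_{\lambda,\gamma}=\sqrt{2\gamma\tilde V_{\lambda,n}\ln n}+\frac{\gamma\ln n}{3n}\|\varphi_\lambda\|_\infty.$$ Let $j_0$ be the integer with $2^{j_0}\le n<2^{j_0+1}$ and $\Gamma_n=\{(j,k)\in\Lambda: j\le j_0\}$. The estimator is $\tilde f^H_{n,\gamma}=\sum_{\lambda\in\Gamma_n}\hat\beta_\lambda 1_{\{|\hat\beta_\lambda|\ge\eta_{\lambda,\gamma}\}}\varphi_\lambda$. *)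

theory Defs
  imports "HOL-Analysis.Analysis"
begin

definition haar_phi :: "real \<Rightarrow> real" where
  "haar_phi x = indicator {0..1} x"

definition haar_psi :: "real \<Rightarrow> real" where
  "haar_psi x = indicator {0..1/2} x - indicator {1/2<..1} x"

text \<open>Indices lambda = (j,k) with j >= -1; j = -1 encodes the father wavelet phi_k.\<close>

definition Lambda :: "(int \<times> int) set" where
  "Lambda = {(j, k). -1 \<le> j}"

definition varphi :: "int \<times> int \<Rightarrow> real \<Rightarrow> real" where
  "varphi lam x = (case lam of (j, k) \<Rightarrow>
     if j = -1 then haar_phi (x - real_of_int k)
     else 2 powr (real_of_int j / 2) * haar_psi (2 powr (real_of_int j) * x - real_of_int k))"

definition sup_norm :: "(real \<Rightarrow> real) \<Rightarrow> real" where
  "sup_norm g = (SUP x. \<bar>g x\<bar>)"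

definition beta :: "(real \<Rightarrow> real) \<Rightarrow> int \<times> int \<Rightarrow> real" where
  "beta f lam = (\<integral>x. varphi lam x * f x \<partial>lborel)"

definition Fmass :: "(real \<Rightarrow> real) \<Rightarrow> int \<times> int \<Rightarrow> real" where
  "Fmass f lam = (\<integral>x\<in>{y. varphi lam y \<noteq> 0}. f x \<partial>lborel)"

definition Fclass :: "nat \<Rightarrow> real \<Rightarrow> (real \<Rightarrow> real) set" where
  "Fclass n R = {f. f \<in> borel_measurable borel \<and> (\<forall>x. 0 \<le> f x)
      \<and> integrable lborel f \<and> integrable lborel (\<lambda>x. (f x)\<^sup>2)
      \<and> (\<integral>x. \<bar>f x\<bar> \<partial>lborel) \<le> R
      \<and> sqrt (\<integral>x. (f x)\<^sup>2 \<partial>lborel) \<le> R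
      \<and> (AE x in lborel. \<bar>f x\<bar> \<le> R)
      \<and> (\<forall>lam\<in>Lambda. Fmass f lam \<ge>
            ln (real n) * ln (ln (real n)) / real n * (if beta f lam \<noteq> 0 then 1 else 0))}"

text \<open>A realisation of the (a.s. finite) Poisson process N is represented by a number k of points
  and the points x 0, ..., x (k-1).\<close>

definition beta_hat :: "nat \<Rightarrow> nat \<Rightarrow> (nat \<Rightarrow> real) \<Rightarrow> int \<times> int \<Rightarrow> real" where
  "beta_hat n k x lam = (1 / real n) * (\<Sum>i<k. varphi lam (x i))"

definition V_hat :: "nat \<Rightarrow> nat \<Rightarrow> (nat \<Rightarrow> real) \<Rightarrow> int \<times> int \<Rightarrow> real" where
  "V_hat n k x lam = (1 / (real n)\<^sup>2) * (\<Sum>i<k. (varphi lam (x i))\<^sup>2)"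

definition V_lam :: "nat \<Rightarrow> (real \<Rightarrow> real) \<Rightarrow> int \<times> int \<Rightarrow> real" where
  "V_lam n f lam = (1 / real n) * (\<integral>x. (varphi lam x)\<^sup>2 * f x \<partial>lborel)"

definition V_tilde :: "real \<Rightarrow> nat \<Rightarrow> nat \<Rightarrow> (nat \<Rightarrow> real) \<Rightarrow> int \<times> int \<Rightarrow> real" where
  "V_tilde \<gamma> n k x lam =
     V_hat n k x lam
     + sqrt (2 * \<gamma> * ln (real n) * V_hat n k x lam * (sup_norm (varphi lam))\<^sup>2 / (real n)\<^sup>2)
     + 3 * \<gamma> * ln (real n) * (sup_norm (varphi lam))\<^sup>2 / (real n)\<^sup>2"

definition eta :: "real \<Rightarrow> nat \<Rightarrow> nat \<Rightarrow> (nat \<Rightarrow> real) \<Rightarrow> int \<times> int \<Rightarrow> real" where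
  "eta \<gamma> n k x lam =
     sqrt (2 * \<gamma> * V_tilde \<gamma> n k x lam * ln (real n))
     + \<gamma> * ln (real n) / (3 * real n) * sup_norm (varphi lam)"

definition j0 :: "nat \<Rightarrow> int" where
  "j0 n = (THE j::int. 2 powr (real_of_int j) \<le> real n \<and> real n < 2 powr (real_of_int j + 1))"

definition Gamma :: "nat \<Rightarrow> (int \<times> int) set" where
  "Gamma n = {(j, k). (j, k) \<in> Lambda \<and> j \<le> j0 n}"

text \<open>The hard-thresholding estimator (pointwise only finitely many terms are nonzero).\<close>

definition f_tilde :: "real \<Rightarrow> nat \<Rightarrow> nat \<Rightarrow> (nat \<Rightarrow> real) \<Rightarrow> real \<Rightarrow> real" where
  "f_tilde \<gamma> n k x y =
     (\<Sum>\<^sub>\<infinity>lam\<in>Gamma n.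
        (if \<bar>beta_hat n k x lam\<bar> \<ge> eta \<gamma> n k x lam then beta_hat n k x lam else 0) * varphi lam y)"

text \<open>For a finite intensity measure mu = n f dx (total mass m), the Poisson process law is:
  the number of points K is Poisson(m), and given K = k the points are i.i.d. with density f / int f.
  Hence E[G(N)] = sum_k exp(-m)/k! int_{R^k} G(x_1..x_k) prod_i (n f(x_i)) dx.\<close>

definition poisson_expect :: "nat \<Rightarrow> (real \<Rightarrow> real) \<Rightarrow> (nat \<Rightarrow> (nat \<Rightarrow> real) \<Rightarrow> ennreal) \<Rightarrow> ennreal" where
  "poisson_expect n f G =
     (\<Sum>k. ennreal (exp (- (real n * (\<integral>y. f y \<partial>lborel))) / fact k) *
        (\<integral>\<^sup>+ x. G k x * (\<Prod>i<k. ennreal (real n * f (x i))) \<partial>(PiM {..<k} (\<lambda>_. lborel))))"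

definition risk :: "real \<Rightarrow> nat \<Rightarrow> (real \<Rightarrow> real) \<Rightarrow> ennreal" where
  "risk \<gamma> n f = poisson_expect n f
     (\<lambda>k x. \<integral>\<^sup>+ y. ennreal ((f_tilde \<gamma> n k x y - f y)\<^sup>2) \<partial>lborel)"

definition oracle_bound :: "nat \<Rightarrow> (real \<Rightarrow> real) \<Rightarrow> ennreal" where
  "oracle_bound n f =
     (\<Sum>\<^sub>\<infinity>lam\<in>Gamma n. ennreal (min ((beta f lam)\<^sup>2) (V_lam n f lam))) + ennreal (1 / real n)"

end

theory Submission
  imports Defs
begin

text \<open>Put \<open>c = (sqrt \<gamma> - sqrt \<gamma>min)\<^sup>2\<close> and perturb the uniform density at one level:
  \<open>f = 1 + a * (\<Sum>k<2^i. \<psi>_{i,k})\<close> on \<open>[0,1]\<close> with \<open>a\<^sup>2 = 2 * c * ln n / n\<close> and \<open>2^i\<close> of order \<open>sqrt n\<close>.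
  Its only nonzero coefficients are the father coefficient \<open>1\<close> and the \<open>2^i\<close> coefficients \<open>a\<close>, all with
  variance \<open>1/n\<close>, so the oracle bound is at most \<open>(2^i + 2) / n\<close>. Since \<open>c < \<gamma>\<close>, each coefficient \<open>a\<close> lies
  a fixed proportion below the threshold, and exponential moments of the Poisson process show that it
  is set to zero with probability tending to one. The risk is then at least \<open>2^i * a\<^sup>2 * (1 - o(1))\<close>,
  which is \<open>2 * c * ln n * (1 - o(1))\<close> times the oracle bound.\<close>

section \<open>Orthonormality of the Haar system\<close>

text \<open>Half-open version of the Haar system: it agrees almost everywhere with \<^const>\<open>varphi\<close>, but its
  supports at a fixed level partition the line, so the value at \<open>x\<close> depends only on a dyadic floor.\<close>

definition haar :: "int \<times> int \<Rightarrow> real \<Rightarrow> real" where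
  "haar lam x = (case lam of (j, k) \<Rightarrow> sqrt (2 ^ nat j) *
     (if j = -1 then of_bool (\<lfloor>x\<rfloor> = k)
      else of_bool (\<lfloor>2 ^ nat (j + 1) * x\<rfloor> = 2 * k) - of_bool (\<lfloor>2 ^ nat (j + 1) * x\<rfloor> = 2 * k + 1)))"

text \<open>Dyadic cells are nested: the index of a fine cell determines the index of every coarser
  cell containing it. All comparisons between levels rest on this.\<close>

lemma floor_dyadic_coarsen:
  "\<lfloor>2 ^ p * x\<rfloor> = \<lfloor>2 ^ (p + d) * x\<rfloor> div 2 ^ d" for x :: real
proof -
  have "\<lfloor>2 ^ (p + d) * x / real_of_int (2 ^ d)\<rfloor> = \<lfloor>2 ^ (p + d) * x\<rfloor> div 2 ^ d"
    by (rule floor_divide_real_eq_div) simp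
  moreover have "2 ^ (p + d) * x / real_of_int (2 ^ d) = 2 ^ p * x"
    by (simp add: power_add)
  ultimately show ?thesis by simp
qed

text \<open>The two halves \<open>2 * k\<close> and \<open>2 * k + 1\<close> merge under
  \<open>div 2\<close> into one cell. Since \<open>nat (-1) = 0\<close>, a single formula covers the
  father function and the wavelets.\<close>

lemma haar_squared:
  assumes "(j, k) \<in> Lambda"
  shows "(haar (j, k) x)\<^sup>2 = 2 ^ nat j * of_bool (\<lfloor>2 ^ nat j * x\<rfloor> = k)"
proof (cases "j = -1")
  case True
  then show ?thesis by (simp add: haar_def)
next
  case False
  then have "nat (j + 1) = nat j + 1" using assms by (simp add: Lambda_def nat_add_distrib)
  then have *: "\<lfloor>2 ^ nat j * x\<rfloor> = \<lfloor>2 ^ nat (j + 1) * x\<rfloor> div 2"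
    using floor_dyadic_coarsen[of "nat j" x 1] by simp
  define m where "m = \<lfloor>2 ^ nat (j + 1) * x\<rfloor>"
  have "m div 2 = k \<longleftrightarrow> m = 2 * k \<or> m = 2 * k + 1" by presburger
  then show ?thesis
    unfolding * m_def[symmetric] using False
    by (simp add: haar_def power_mult_distrib m_def[symmetric] of_bool_def)
qed

lemma haar_support:
  assumes "(j, k) \<in> Lambda" "haar (j, k) x \<noteq> 0"
  shows "\<lfloor>2 ^ nat j * x\<rfloor> = k"
  using haar_squared[OF assms(1), of x] assms(2) by (cases "\<lfloor>2 ^ nat j * x\<rfloor> = k") auto

text \<open>This allows the coarser of two Haar functions to be treated as a constant on the support
  of the finer one.\<close>

lemma haar_eq_of_floor_eq:
  assumes "(j, k) \<in> Lambda" "nat (j + 1) \<le> p" "\<lfloor>2 ^ p * x\<rfloor> = \<lfloor>2 ^ p * y\<rfloor>"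
  shows "haar (j, k) x = haar (j, k) y"
proof -
  have "\<lfloor>2 ^ nat (j + 1) * x\<rfloor> = \<lfloor>2 ^ nat (j + 1) * y\<rfloor>"
    using floor_dyadic_coarsen[of "nat (j + 1)" _ "p - nat (j + 1)"] assms by simp
  then show ?thesis
    by (auto simp: haar_def)
qed

text \<open>The only values are 0 and plus or minus the height \<open>sqrt (2 ^ nat j)\<close>. The
  identity serves to integrate a squared wavelet against a density that contains that
  wavelet.\<close>

lemma haar_cubed:
  assumes "(j, k) \<in> Lambda"
  shows "(haar (j, k) x)\<^sup>2 * haar (j, k) x = 2 ^ nat j * haar (j, k) x"
  using haar_support[OF assms, of x] by (cases "haar (j, k) x = 0") (auto simp: haar_squared[OF assms])

lemma has_bochner_integral_floor_eq:
  assumes "c > 0"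
  shows "has_bochner_integral lborel (\<lambda>x. of_bool (\<lfloor>c * x\<rfloor> = m) :: real) (1 / c)"
proof -
  have "(\<lambda>x. of_bool (\<lfloor>c * x\<rfloor> = m) :: real) = indicator {m / c ..< (m + 1) / c}"
    using assms by (auto simp: fun_eq_iff indicator_def floor_eq_iff field_simps)
  moreover have "measure lborel {m / c ..< (m + 1) / c} = 1 / c"
    using assms by (subst measure_lborel_Ico) (auto simp: field_simps)
  ultimately show ?thesis
    using has_bochner_integral_real_indicator[of "{m / c ..< (m + 1) / c}" lborel] assms
    by (simp add: emeasure_lborel_Ico divide_right_mono)
qed

lemma haar_has_integral:
  assumes "(j, k) \<in> Lambda"
  shows "has_bochner_integral lborel (haar (j, k)) (of_bool (j = -1))"
proof (cases "j = -1")
  case True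
  then show ?thesis
    using has_bochner_integral_floor_eq[of 1 k] by (simp add: haar_def[abs_def])
next
  case False
  have "has_bochner_integral lborel (\<lambda>x::real. sqrt (2 ^ nat j) *
     (of_bool (\<lfloor>2 ^ nat (j + 1) * x\<rfloor> = 2 * k) - of_bool (\<lfloor>2 ^ nat (j + 1) * x\<rfloor> = 2 * k + 1)))
     (sqrt (2 ^ nat j) * (1 / 2 ^ nat (j + 1) - 1 / 2 ^ nat (j + 1)))"
    by (intro has_bochner_integral_mult_right has_bochner_integral_diff has_bochner_integral_floor_eq) auto
  with False show ?thesis by (simp add: haar_def[abs_def])
qed

lemma haar_squared_has_integral:
  assumes "(j, k) \<in> Lambda"
  shows "has_bochner_integral lborel (\<lambda>x. (haar (j, k) x)\<^sup>2) 1"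
proof -
  have "has_bochner_integral lborel (\<lambda>x::real. 2 ^ nat j * of_bool (\<lfloor>2 ^ nat j * x\<rfloor> = k) :: real) (2 ^ nat j * (1 / 2 ^ nat j))"
    by (intro has_bochner_integral_mult_right has_bochner_integral_floor_eq) auto
  then show ?thesis by (simp add: haar_squared[OF assms])
qed

lemma haar_measurable [measurable]: "haar lam \<in> borel_measurable borel"
  unfolding haar_def[abs_def] by (cases lam) simp

lemma integrable_haar_mult:
  assumes "lam \<in> Lambda" "mu \<in> Lambda"
  shows "integrable lborel (\<lambda>x. haar lam x * haar mu x)"
proof (rule Bochner_Integration.integrable_bound)
  show "integrable lborel (\<lambda>x. (haar lam x)\<^sup>2 + (haar mu x)\<^sup>2)"
    using haar_squared_has_integral assms
    by (intro Bochner_Integration.integrable_add) (metis integrable.intros surj_pair)+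
  have "\<bar>a * b\<bar> \<le> a\<^sup>2 + b\<^sup>2" for a b :: real
    using sum_squares_bound[of "\<bar>a\<bar>" "\<bar>b\<bar>"] abs_ge_zero[of "a * b"]
    by (simp only: abs_mult power2_abs)
  then show "AE x in lborel. norm (haar lam x * haar mu x) \<le> norm ((haar lam x)\<^sup>2 + (haar mu x)\<^sup>2)"
    by simp
qed simp

text \<open>At equal levels distinct supports are disjoint. At different levels the coarser function
  is constant on the support of the finer one, which has mean zero because its level is at least
  0.\<close>

lemma haar_orthonormal:
  assumes "lam \<in> Lambda" "mu \<in> Lambda"
  shows "(\<integral>x. haar lam x * haar mu x \<partial>lborel) = of_bool (lam = mu)"
proof -
  have *: "(\<integral>x. haar (j, k) x * haar (j', k') x \<partial>lborel) = 0"
    if L: "(j, k) \<in> Lambda" "(j', k') \<in> Lambda" and j: "j \<le> j'" and ne: "(j, k) \<noteq> (j', k')" for j k j' k'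
  proof (cases "j = j'")
    case True
    then have "haar (j, k) x * haar (j', k') x = 0" for x
      using haar_support[OF L(1), of x] haar_support[OF L(2), of x] ne by auto
    then show ?thesis by (simp only: integral_zero)
  next
    case False
    \<comment> \<open>The sample point \<open>k' / 2 ^ nat j'\<close> is the left end of the finer
      cell.\<close>
    have "haar (j, k) x * haar (j', k') x = haar (j, k) (k' / 2 ^ nat j') * haar (j', k') x" for x
    proof (cases "haar (j', k') x = 0")
      case nz: False
      have "haar (j, k) x = haar (j, k) (k' / 2 ^ nat j')"
        by (rule haar_eq_of_floor_eq[where p = "nat j'"])
           (use L False j haar_support[OF L(2) nz] in auto)
      then show ?thesis by simp
    qed simp
    moreover have "(\<integral>x. haar (j', k') x \<partial>lborel) = 0"
      using haar_has_integral[OF L(2)] False j L by (auto simp: has_bochner_integral_iff Lambda_def)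
    ultimately show ?thesis by (simp only: integral_mult_right_zero)
  qed
  obtain j k j' k' where lm: "lam = (j, k)" "mu = (j', k')" by (metis surj_pair)
  show ?thesis
  proof (cases "lam = mu")
    case True
    then show ?thesis using haar_squared_has_integral assms lm
      by (auto simp: has_bochner_integral_iff power2_eq_square)
  next
    case False
    then show ?thesis using *[of j k j' k'] *[of j' k' j k] assms lm
      by (cases "j \<le> j'") (auto simp: mult.commute)
  qed
qed

text \<open>The closed and half-open versions can differ only at end points and midpoints of
  supports, and these become integers after scaling by \<open>2 ^ nat (j + 1)\<close>.\<close>

lemma varphi_eq_haar:
  assumes "(j, k) \<in> Lambda" "2 ^ nat (j + 1) * x \<notin> \<int>"
  shows "varphi (j, k) x = haar (j, k) x"
proof (cases "j = -1")
  case True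
  then have "x \<noteq> real_of_int k" "x \<noteq> real_of_int (k + 1)" using assms(2) by auto
  then show ?thesis using True
    by (auto simp: varphi_def haar_def haar_phi_def indicator_def floor_eq_iff)
next
  case False
  define t where "t = 2 ^ nat j * x"
  have j: "j \<ge> 0" using False assms by (auto simp: Lambda_def)
  have e: "2 ^ nat (j + 1) * x = 2 * t" using j by (simp add: t_def nat_add_distrib)
  have p: "2 powr real_of_int j = 2 ^ nat j" using j by (simp add: powr_real_of_int)
  have q: "2 powr (real_of_int j / 2) = sqrt (2 ^ nat j)"
    unfolding p[symmetric] by (simp add: powr_half_sqrt[symmetric] powr_powr)
  have "2 * t \<noteq> of_int (2 * k)" "2 * t \<noteq> of_int (2 * k + 1)" "2 * t \<noteq> of_int (2 * k + 2)"
    using assms(2) unfolding e by (metis Ints_of_int)+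
  then have "haar_psi (t - k) = of_bool (\<lfloor>2 * t\<rfloor> = 2 * k) - of_bool (\<lfloor>2 * t\<rfloor> = 2 * k + 1)"
    by (auto simp: haar_psi_def indicator_def floor_eq_iff)
  then show ?thesis using False
    by (simp add: varphi_def haar_def p q e t_def[symmetric])
qed

lemma AE_varphi_eq_haar:
  assumes "lam \<in> Lambda"
  shows "AE x in lborel. varphi lam x = haar lam x"
proof -
  obtain j k where lam: "lam = (j, k)" by fastforce
  define c :: real where "c = 2 ^ nat (j + 1)"
  have "c > 0" by (simp add: c_def)
  then have "{x. c * x \<in> \<int>} \<subseteq> (\<lambda>z. z / c) ` \<int>" by (force simp: image_iff)
  then have "countable {x. c * x \<in> \<int>}" by (rule countable_subset) (intro countable_image countable_int)
  then have "AE x in lborel. x \<notin> {x. c * x \<in> \<int>}"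
    by (intro AE_not_in countable_imp_null_set_lborel)
  then show ?thesis
    using varphi_eq_haar assms unfolding lam c_def by (auto elim!: eventually_mono)
qed

lemma varphi_measurable [measurable]: "varphi lam \<in> borel_measurable borel"
  unfolding varphi_def[abs_def] haar_phi_def haar_psi_def by (cases lam) simp

section \<open>Exponential moments of a Poisson process\<close>

lemma poisson_expect_mono:
  assumes "\<And>k x. G k x \<le> H k x"
  shows "poisson_expect n f G \<le> poisson_expect n f H"
  unfolding poisson_expect_def
  by (intro suminf_le mult_left_mono nn_integral_mono mult_right_mono assms) auto

lemma poisson_weight_measurable:
  assumes [measurable]: "f \<in> borel_measurable borel"
  shows "(\<lambda>x. \<Prod>i<k. ennreal (real n * f (x i))) \<in> borel_measurable (PiM {..<k} (\<lambda>_. lborel))"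
  by measurable

lemma poisson_expect_add:
  assumes "f \<in> borel_measurable borel"
    and "\<And>k. G k \<in> borel_measurable (PiM {..<k} (\<lambda>_. lborel))"
    and "\<And>k. H k \<in> borel_measurable (PiM {..<k} (\<lambda>_. lborel))"
  shows "poisson_expect n f (\<lambda>k x. G k x + H k x) = poisson_expect n f G + poisson_expect n f H"
  unfolding poisson_expect_def
  by (subst suminf_add[OF summableI summableI])
     (simp add: distrib_right distrib_left nn_integral_add borel_measurable_times_ennreal
        poisson_weight_measurable assms)

lemma poisson_expect_cmult:
  assumes "f \<in> borel_measurable borel"
    and "\<And>k. G k \<in> borel_measurable (PiM {..<k} (\<lambda>_. lborel))"
  shows "poisson_expect n f (\<lambda>k x. c * G k x) = c * poisson_expect n f G"
  unfolding poisson_expect_def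
  by (subst ennreal_suminf_cmult[symmetric])
     (simp add: nn_integral_cmult borel_measurable_times_ennreal poisson_weight_measurable assms mult.assoc
       mult.left_commute)

text \<open>This is the Laplace functional of a Poisson process. For a fixed number \<open>k\<close>
  of points the integral factorises into \<open>I ^ k\<close>, and the Poisson weights sum the
  series to \<open>exp (I - m)\<close>.\<close>

lemma poisson_expect_exp_sum:
  assumes [measurable]: "f \<in> borel_measurable borel" "g \<in> borel_measurable borel"
    and nonneg: "\<And>x. 0 \<le> f x"
    and int: "integrable lborel f" "integrable lborel (\<lambda>x. (exp (g x) - 1) * f x)"
  shows "poisson_expect n f (\<lambda>k x. ennreal (exp (\<Sum>i<k. g (x i))))
    = ennreal (exp (real n * (\<integral>x. (exp (g x) - 1) * f x \<partial>lborel)))"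
proof -
  interpret product_sigma_finite "\<lambda>_::nat. lborel :: real measure" ..
  define m where "m = real n * (\<integral>y. f y \<partial>lborel)"
  define I where "I = (\<integral>x. exp (g x) * (real n * f x) \<partial>lborel)"
  have i: "integrable lborel (\<lambda>x. exp (g x) * f x)"
    using Bochner_Integration.integrable_add[OF int(2,1)] by (simp add: algebra_simps)
  then have i': "integrable lborel (\<lambda>x. exp (g x) * (real n * f x))"
    by (simp add: mult.left_commute[of _ "real n"])
  have I0: "I \<ge> 0" unfolding I_def by (intro integral_nonneg_AE) (simp add: nonneg)
  have "(\<integral>\<^sup>+ x. ennreal (exp (\<Sum>i<k. g (x i))) * (\<Prod>i<k. ennreal (real n * f (x i))) \<partial>(PiM {..<k} (\<lambda>_. lborel)))
      = ennreal (I ^ k)" for k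
  proof -
    have "(\<integral>\<^sup>+ x. ennreal (exp (\<Sum>i<k. g (x i))) * (\<Prod>i<k. ennreal (real n * f (x i))) \<partial>(PiM {..<k} (\<lambda>_. lborel)))
      = (\<integral>\<^sup>+ x. (\<Prod>i<k. ennreal (exp (g (x i)) * (real n * f (x i)))) \<partial>(PiM {..<k} (\<lambda>_. lborel)))"
      by (intro nn_integral_cong)
         (simp add: exp_sum prod_ennreal[symmetric] prod.distrib ennreal_mult nonneg)
    also have "\<dots> = (\<Prod>i<k. \<integral>\<^sup>+ x. ennreal (exp (g x) * (real n * f x)) \<partial>lborel)"
      by (rule product_nn_integral_prod) auto
    also have "(\<integral>\<^sup>+ x. ennreal (exp (g x) * (real n * f x)) \<partial>lborel) = ennreal I"
      unfolding I_def by (intro nn_integral_eq_integral i') (simp add: nonneg)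
    finally show ?thesis using I0 by (simp add: ennreal_power)
  qed
  then have "poisson_expect n f (\<lambda>k x. ennreal (exp (\<Sum>i<k. g (x i))))
      = (\<Sum>k. ennreal (exp (- m) * (I ^ k / fact k)))"
    unfolding poisson_expect_def m_def[symmetric] by (simp add: ennreal_mult[symmetric] I0)
  also have "\<dots> = ennreal (exp (- m) * exp I)"
    using sums_mult[OF exp_converges[of I], of "exp (- m)"] I0
    by (intro suminf_ennreal_eq) (auto simp: divide_inverse mult.commute)
  also have "exp (- m) * exp I = exp (I - m)" by (simp add: exp_diff exp_minus divide_inverse)
  also have "I - m = real n * (\<integral>x. (exp (g x) - 1) * f x \<partial>lborel)"
  proof -
    have "I = real n * (\<integral>x. exp (g x) * f x \<partial>lborel)"
      unfolding I_def by (simp add: mult.left_commute[of _ "real n"])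
    then show ?thesis unfolding m_def
      by (simp add: left_diff_distrib Bochner_Integration.integral_diff[OF i int(1)] right_diff_distrib)
  qed
  finally show ?thesis .
qed

lemma poisson_expect_1:
  assumes "f \<in> borel_measurable borel" "\<And>x. 0 \<le> f x" "integrable lborel f"
  shows "poisson_expect n f (\<lambda>k x. 1) = 1"
  using poisson_expect_exp_sum[of f "\<lambda>_. 0" n] assms by simp

section \<open>The hard-thresholding estimator\<close>

text \<open>Each point meets only finitely many supports per level, which makes the estimator a
  finite sum.\<close>

lemma varphi_support:
  assumes "varphi (j, k) y \<noteq> 0"
  shows "k \<in> {\<lceil>(if j = -1 then y else 2 powr j * y) - 1\<rceil>..\<lfloor>if j = -1 then y else 2 powr j * y\<rfloor>}"
proof -
  define t where "t = (if j = -1 then y else 2 powr j * y)"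
  have "0 \<le> t - k \<and> t - k \<le> 1"
    using assms
    by (auto simp: varphi_def haar_phi_def haar_psi_def t_def indicator_def of_bool_def split: if_splits)
  then show ?thesis unfolding t_def[symmetric] 
    by (simp only: atLeastAtMost_iff ceiling_le_iff le_floor_iff) linarith
qed

lemma sup_norm_varphi_nonneg: "0 \<le> sup_norm (varphi lam)"
proof -
  obtain j k where lam: "lam = (j, k)" by fastforce
  have "\<bar>varphi lam x\<bar> \<le> 1 + 2 powr (real_of_int j / 2)" for x
    by (simp add: lam varphi_def haar_phi_def haar_psi_def indicator_def)
  then have "bdd_above (range (\<lambda>x. \<bar>varphi lam x\<bar>))" by (auto intro!: bdd_aboveI)
  from cSUP_upper2[OF this, of 0 0] show ?thesis by (simp add: sup_norm_def)
qed

text \<open>The correction terms in the threshold are nonnegative. The remaining main term is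
  already large enough to remove the planted coefficients.\<close>

lemma eta_ge:
  assumes "\<gamma> \<ge> 0" "n \<ge> 1"
  shows "sqrt (2 * \<gamma> * V_hat n k x lam * ln (real n)) \<le> eta \<gamma> n k x lam"
proof -
  have L: "ln (real n) \<ge> 0" using assms(2) by simp
  have V: "V_hat n k x lam \<ge> 0" by (simp add: V_hat_def sum_nonneg)
  have "V_hat n k x lam \<le> V_tilde \<gamma> n k x lam"
    unfolding V_tilde_def using L V assms by simp
  then have "sqrt (2 * \<gamma> * V_hat n k x lam * ln (real n)) \<le> sqrt (2 * \<gamma> * V_tilde \<gamma> n k x lam * ln (real n))"
    using assms L by (intro real_sqrt_le_mono mult_right_mono mult_left_mono) auto
  moreover have "0 \<le> \<gamma> * ln (real n) / (3 * real n) * sup_norm (varphi lam)"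
    using assms L sup_norm_varphi_nonneg by simp
  ultimately show ?thesis unfolding eta_def by linarith
qed

text \<open>A nonzero empirical coefficient needs a point of the process in its support, and
  \<open>Gamma n\<close> has finitely many levels. Orthonormality can then be applied to a finite
  combination.\<close>

lemma f_tilde_finite_sum:
  fixes \<gamma> n k x
  defines "c \<equiv> \<lambda>lam. if \<bar>beta_hat n k x lam\<bar> \<ge> eta \<gamma> n k x lam then beta_hat n k x lam else 0"
  defines "A \<equiv> {lam \<in> Gamma n. c lam \<noteq> 0}"
  shows "finite A" and "f_tilde \<gamma> n k x y = (\<Sum>lam\<in>A. c lam * varphi lam y)"
proof -
  define t where "t j y = (if j = -1 then y else 2 powr (real_of_int j) * y)" for j :: int and y :: real
  have "A \<subseteq> (\<Union>l<k. \<Union>j\<in>{-1..j0 n}. {j} \<times> {\<lceil>t j (x l) - 1\<rceil>..\<lfloor>t j (x l)\<rfloor>})"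
  proof
    fix lam assume lam: "lam \<in> A"
    obtain j m where jm: "lam = (j, m)" by fastforce
    have "beta_hat n k x lam \<noteq> 0" using lam by (auto simp: A_def c_def split: if_splits)
    then obtain l where "l < k" "varphi lam (x l) \<noteq> 0"
      unfolding beta_hat_def by (metis lessThan_iff mult_zero_right sum.neutral)
    moreover have "j \<in> {-1..j0 n}" using lam jm by (auto simp: A_def Gamma_def Lambda_def)
    ultimately show "lam \<in> (\<Union>l<k. \<Union>j\<in>{-1..j0 n}. {j} \<times> {\<lceil>t j (x l) - 1\<rceil>..\<lfloor>t j (x l)\<rfloor>})"
      using varphi_support[of j m "x l"] unfolding jm t_def by blast
  qed
  then show fin: "finite A" by (rule finite_subset) auto
  have "f_tilde \<gamma> n k x y = (\<Sum>\<^sub>\<infinity>lam\<in>A. c lam * varphi lam y)"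
    unfolding f_tilde_def
    by (rule infsum_cong_neutral) (auto simp: A_def c_def)
  then show "f_tilde \<gamma> n k x y = (\<Sum>lam\<in>A. c lam * varphi lam y)"
    using fin by simp
qed

text \<open>For \<open>u = - v\<close> with \<open>v > 0\<close>, combine
  \<open>(1 - v + v\<^sup>2) * (1 + v) = 1 + v ^ 3 \<ge> 1\<close> with
  \<open>1 + v \<le> exp v\<close>.\<close>

lemma exp_le_quadratic:
  fixes u :: real
  assumes "\<bar>u\<bar> \<le> 1"
  shows "exp u \<le> 1 + u + u\<^sup>2"
proof (cases "u \<ge> 0")
  case True
  then show ?thesis using exp_bound assms by simp
next
  case False
  define v where "v = - u"
  have v: "v > 0" using False by (simp add: v_def)
  have "1 \<le> (1 - v + v\<^sup>2) * (1 + v)"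
    using v by (simp add: algebra_simps power2_eq_square)
  also have "\<dots> \<le> (1 - v + v\<^sup>2) * exp v"
  proof (rule mult_left_mono)
    show "0 \<le> 1 - v + v\<^sup>2" using v zero_le_power2[of "1 - v"] by (simp add: power2_diff)
  qed (simp add: exp_ge_add_one_self)
  finally have "exp (- v) \<le> 1 - v + v\<^sup>2" by (simp add: exp_minus field_simps)
  then show ?thesis by (simp add: v_def)
qed

text \<open>The values lie in \<open>ennreal\<close> so that \<open>poisson_expect\<close> of this
  indicator is directly the probability of thresholding to zero.\<close>

definition killed :: "real \<Rightarrow> nat \<Rightarrow> int \<times> int \<Rightarrow> nat \<Rightarrow> (nat \<Rightarrow> real) \<Rightarrow> ennreal" where
  "killed \<gamma> n lam k x = of_bool (\<bar>beta_hat n k x lam\<bar> < eta \<gamma> n k x lam)"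

lemma ennreal_inverse_antimono: "x \<le> y \<Longrightarrow> inverse y \<le> inverse x" for x y :: ennreal
  including ennreal.lifting by transfer (rule ereal_inverse_antimono)

section \<open>The perturbed intensity\<close>

lemma haar_abs_le:
  assumes "(j, k) \<in> Lambda"
  shows "\<bar>haar (j, k) x\<bar> \<le> sqrt (2 ^ nat j)"
  by (rule real_le_rsqrt) (simp add: haar_squared[OF assms])

text \<open>The second condition keeps the oscillation within height 1, so the perturbed density
  stays between 0 and 2.\<close>

context
  fixes i :: nat and a :: real
  assumes a_nonneg: "0 \<le> a" and a_le: "a * sqrt (2 ^ i) \<le> 1"
begin

definition wavelet_level :: "(int \<times> int) set" where
  "wavelet_level = {int i} \<times> {0..<2 ^ i}"

definition bumpy :: "real \<Rightarrow> real" where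
  "bumpy x = haar (-1, 0) x + a * (\<Sum>lam\<in>wavelet_level. haar lam x)"

lemma finite_wavelet_level [simp]: "finite wavelet_level" and card_wavelet_level: "card wavelet_level = 2 ^ i"
  by (simp_all add: wavelet_level_def nat_power_eq)

lemma wavelet_level_subset: "wavelet_level \<subseteq> Lambda" and father_in_Lambda [simp]: "(-1, 0) \<in> Lambda"
  and father_notin_wavelet_level [simp]: "(-1, 0) \<notin> wavelet_level"
  by (auto simp: wavelet_level_def Lambda_def)

text \<open>Wavelets of one level have disjoint supports, and those chosen here lie in the unit
  cell, so only the father function and one wavelet contribute.\<close>

lemma bumpy_eq_on_support:
  assumes "lam \<in> wavelet_level" "haar lam x \<noteq> 0"
  shows "bumpy x = 1 + a * haar lam x"
proof -
  obtain k where lam: "lam = (int i, k)" and k: "0 \<le> k" "k < 2 ^ i"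
    using assms(1) by (auto simp: wavelet_level_def)
  have L: "(int i, k') \<in> Lambda" for k' by (simp add: Lambda_def)
  have fl: "\<lfloor>2 ^ i * x\<rfloor> = k"
    using haar_support[OF L assms(2)[unfolded lam]] by simp
  then have "\<lfloor>x\<rfloor> = k div 2 ^ i"
    using floor_dyadic_coarsen[of 0 x i] by simp
  then have "haar (-1, 0) x = 1" using k by (simp add: haar_def)
  moreover have "haar mu x = 0" if "mu \<in> wavelet_level - {lam}" for mu
    using that haar_support[OF L, of "snd mu" x] fl by (auto simp: wavelet_level_def lam)
  then have "(\<Sum>mu\<in>wavelet_level. haar mu x) = haar lam x"
    using assms(1) by (subst sum.remove[of _ lam]) auto
  ultimately show ?thesis by (simp add: bumpy_def)
qed

lemma bumpy_bounds: "0 \<le> bumpy x" "bumpy x \<le> 2"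
proof -
  have "0 \<le> bumpy x \<and> bumpy x \<le> 2"
  proof (cases "\<exists>lam\<in>wavelet_level. haar lam x \<noteq> 0")
    case True
    then obtain lam where lam: "lam \<in> wavelet_level" "haar lam x \<noteq> 0" by blast
    then have "\<bar>haar lam x\<bar> \<le> sqrt (2 ^ i)"
      using haar_abs_le[of "int i" "snd lam" x] by (auto simp: wavelet_level_def Lambda_def)
    then have "\<bar>a * haar lam x\<bar> \<le> a * sqrt (2 ^ i)"
      using a_nonneg by (simp add: abs_mult mult_left_mono)
    then show ?thesis using a_le bumpy_eq_on_support[OF lam] by linarith
  next
    case False
    then show ?thesis by (simp add: bumpy_def haar_def)
  qed
  then show "0 \<le> bumpy x" "bumpy x \<le> 2" by auto
qed

lemma bumpy_measurable [measurable]: "bumpy \<in> borel_measurable borel"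
  unfolding bumpy_def[abs_def] by measurable

lemma bumpy_has_integral: "has_bochner_integral lborel bumpy 1"
proof -
  have "has_bochner_integral lborel (haar lam) 0" if "lam \<in> wavelet_level" for lam
    using haar_has_integral[of "fst lam" "snd lam"] that wavelet_level_subset by (auto simp: wavelet_level_def)
  then have "has_bochner_integral lborel (\<lambda>x. haar (-1, 0) x + a * (\<Sum>lam\<in>wavelet_level. haar lam x))
     (of_bool (-1 = (-1::int)) + a * (\<Sum>lam\<in>wavelet_level. 0))"
    by (intro has_bochner_integral_add has_bochner_integral_mult_right has_bochner_integral_sum
        haar_has_integral) auto
  then show ?thesis by (simp add: bumpy_def[abs_def])
qed

section \<open>Coefficients, variances and masses of the perturbed density\<close>

lemma integrable_haar_bumpy:
  assumes "lam \<in> Lambda"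
  shows "integrable lborel (\<lambda>x. haar lam x * bumpy x)"
  unfolding bumpy_def distrib_left mult.left_commute[of _ a] sum_distrib_left using assms wavelet_level_subset
  by (intro Bochner_Integration.integrable_add integrable_mult_right Bochner_Integration.integrable_sum
      integrable_haar_mult) auto

lemma integral_haar_bumpy:
  assumes "lam \<in> Lambda"
  shows "(\<integral>x. haar lam x * bumpy x \<partial>lborel) = of_bool (lam = (-1, 0)) + a * of_bool (lam \<in> wavelet_level)"
proof -
  have "(\<integral>x. haar lam x * bumpy x \<partial>lborel) = (\<integral>x. haar lam x * haar (-1, 0) x
      + a * (\<Sum>mu\<in>wavelet_level. haar lam x * haar mu x) \<partial>lborel)"
    by (simp add: bumpy_def distrib_left mult.left_commute[of _ a] sum_distrib_left)
  also have "\<dots> = (\<integral>x. haar lam x * haar (-1, 0) x \<partial>lborel)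
      + a * (\<Sum>mu\<in>wavelet_level. \<integral>x. haar lam x * haar mu x \<partial>lborel)"
    using assms wavelet_level_subset
    by (subst Bochner_Integration.integral_add)
       (auto intro!: integrable_mult_right Bochner_Integration.integrable_sum integrable_haar_mult
         Bochner_Integration.integral_sum simp: subset_iff)
  also have "(\<Sum>mu\<in>wavelet_level. \<integral>x. haar lam x * haar mu x \<partial>lborel) = (\<Sum>mu\<in>wavelet_level. of_bool (lam = mu))"
    using assms wavelet_level_subset by (intro sum.cong) (auto simp: haar_orthonormal subset_iff)
  also have "\<dots> = of_bool (lam \<in> wavelet_level)"
    by (simp add: of_bool_def)
  finally show ?thesis using assms by (simp add: haar_orthonormal)
qed

text \<open>On the support the integrand is \<open>(haar lam x)\<^sup>2\<close> plus a multiple of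
  \<open>haar lam x\<close>, and the latter integrates to zero. The perturbation therefore leaves
  these variances unchanged.\<close>

lemma haar_squared_bumpy_has_integral:
  assumes "lam \<in> wavelet_level"
  shows "has_bochner_integral lborel (\<lambda>x. (haar lam x)\<^sup>2 * bumpy x) 1"
proof -
  obtain k where lam: "lam = (int i, k)" using assms by (auto simp: wavelet_level_def)
  have L: "(int i, k) \<in> Lambda" by (simp add: Lambda_def)
  have "(haar lam x)\<^sup>2 * bumpy x = (haar lam x)\<^sup>2 + a * 2 ^ i * haar lam x" for x
    using bumpy_eq_on_support[OF assms, of x] haar_cubed[OF L, of x]
    by (cases "haar lam x = 0") (auto simp: lam algebra_simps)
  moreover have "has_bochner_integral lborel (\<lambda>x. (haar lam x)\<^sup>2 + a * 2 ^ i * haar lam x) (1 + a * 2 ^ i * 0)"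
    unfolding lam using haar_has_integral[OF L]
    by (intro has_bochner_integral_add has_bochner_integral_mult_right haar_squared_has_integral[OF L]) simp
  ultimately show ?thesis by simp
qed

lemma beta_bumpy:
  assumes "lam \<in> Lambda"
  shows "beta bumpy lam = of_bool (lam = (-1, 0)) + a * of_bool (lam \<in> wavelet_level)"
proof -
  have "beta bumpy lam = (\<integral>x. haar lam x * bumpy x \<partial>lborel)"
    unfolding beta_def using AE_varphi_eq_haar[OF assms]
    by (intro integral_cong_AE) (auto elim!: eventually_mono)
  then show ?thesis using integral_haar_bumpy[OF assms] by simp
qed

text \<open>Every wavelet of the level lives inside the unit cell, so \<open>bumpy\<close> vanishes
  wherever the father function does.\<close>

lemma haar_father_squared_bumpy: "(haar (-1, 0) x)\<^sup>2 * bumpy x = bumpy x"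
proof (cases "\<exists>lam\<in>wavelet_level. haar lam x \<noteq> 0")
  case True
  then obtain k where k: "0 \<le> k" "k < 2 ^ i" "haar (int i, k) x \<noteq> 0" by (auto simp: wavelet_level_def)
  then have "\<lfloor>2 ^ i * x\<rfloor> = k"
    using haar_support[of "int i" k x] by (simp add: Lambda_def)
  then have "\<lfloor>x\<rfloor> = 0"
    using floor_dyadic_coarsen[of 0 x i] k by simp
  then show ?thesis by (simp add: haar_def)
next
  case False
  then show ?thesis by (auto simp: bumpy_def haar_def)
qed

lemma haar_squared_bumpy_integral:
  assumes "lam \<in> insert (-1, 0) wavelet_level"
  shows "(\<integral>x. (haar lam x)\<^sup>2 * bumpy x \<partial>lborel) = 1"
  using assms haar_squared_bumpy_has_integral[of lam, THEN has_bochner_integral_integral_eq]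
    bumpy_has_integral[THEN has_bochner_integral_integral_eq]
  by (auto simp: haar_father_squared_bumpy)

lemma V_lam_bumpy:
  assumes "lam \<in> insert (-1, 0) wavelet_level"
  shows "V_lam n bumpy lam = 1 / n"
proof -
  have L: "lam \<in> Lambda" using assms wavelet_level_subset by auto
  have "(\<integral>x. (varphi lam x)\<^sup>2 * bumpy x \<partial>lborel) = (\<integral>x. (haar lam x)\<^sup>2 * bumpy x \<partial>lborel)"
    using AE_varphi_eq_haar[OF L] by (intro integral_cong_AE) (auto elim!: eventually_mono)
  then show ?thesis unfolding V_lam_def by (simp add: haar_squared_bumpy_integral[OF assms])
qed

text \<open>The indicator of the support is almost everywhere the squared Haar function divided by
  \<open>2 ^ nat j\<close>, so the mass is exactly \<open>1 / 2 ^ nat j\<close>; the smallest such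
  mass occurs at level \<open>i\<close>.\<close>

lemma Fmass_bumpy:
  assumes "lam \<in> insert (-1, 0) wavelet_level"
  shows "Fmass bumpy lam \<ge> 1 / 2 ^ i"
proof -
  have L: "lam \<in> Lambda" using assms wavelet_level_subset by auto
  obtain j k where lam: "lam = (j, k)" by fastforce
  have "Fmass bumpy lam = (\<integral>x. (1 / 2 ^ nat j) * ((haar lam x)\<^sup>2 * bumpy x) \<partial>lborel)"
    unfolding Fmass_def set_lebesgue_integral_def
  proof (rule integral_cong_AE)
    show "AE x in lborel. indicat_real {y. varphi lam y \<noteq> 0} x *\<^sub>R bumpy x = (1 / 2 ^ nat j) * ((haar lam x)\<^sup>2 * bumpy x)"
      using AE_varphi_eq_haar[OF L]
    proof (rule eventually_mono)
      fix x assume "varphi lam x = haar lam x"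
      then show "indicat_real {y. varphi lam y \<noteq> 0} x *\<^sub>R bumpy x = (1 / 2 ^ nat j) * ((haar lam x)\<^sup>2 * bumpy x)"
        using haar_squared[OF L[unfolded lam], of x] haar_support[OF L[unfolded lam], of x]
        by (auto simp: lam indicator_def)
    qed
  qed measurable
  also have "\<dots> = 1 / 2 ^ nat j"
    by (simp add: haar_squared_bumpy_integral[OF assms])
  finally show ?thesis using assms by (auto simp: lam wavelet_level_def)
qed

text \<open>The mass constraint can bite only at the father and level \<open>i\<close> indices,
  where masses are at least \<open>1 / 2 ^ i\<close>. The bound \<open>bumpy x \<le> 2\<close> gives
  the sup norm and, through \<open>f\<^sup>2 \<le> 2 * f\<close>, the \<open>L_2\<close>
  norm.\<close>

lemma bumpy_in_Fclass:
  assumes "R \<ge> 2" "ln (real n) * ln (ln (real n)) / real n \<le> 1 / 2 ^ i"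
  shows "bumpy \<in> Fclass n R"
proof -
  have int: "integrable lborel bumpy" "(\<integral>x. bumpy x \<partial>lborel) = 1"
    using bumpy_has_integral by (auto simp: has_bochner_integral_iff)
  have sq: "(bumpy x)\<^sup>2 \<le> 2 * bumpy x" for x
    using bumpy_bounds[of x] by (simp add: power2_eq_square mult_right_mono)
  have int2: "integrable lborel (\<lambda>x. (bumpy x)\<^sup>2)"
    by (rule Bochner_Integration.integrable_bound[of lborel "\<lambda>x. 2 * bumpy x"])
       (use int(1) bumpy_bounds sq in \<open>auto simp: abs_mult\<close>)
  have "(\<integral>x. (bumpy x)\<^sup>2 \<partial>lborel) \<le> (\<integral>x. 2 * bumpy x \<partial>lborel)"
    by (intro integral_mono int2 sq) (simp add: int)
  also have "\<dots> \<le> R\<^sup>2" using int assms(1) power_mono[of 2 R 2] by simp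
  finally have "sqrt (\<integral>x. (bumpy x)\<^sup>2 \<partial>lborel) \<le> R"
    using assms(1) by (intro real_le_lsqrt) auto
  moreover have "Fmass bumpy lam \<ge> ln (real n) * ln (ln (real n)) / real n * (if beta bumpy lam \<noteq> 0 then 1 else 0)"
    if "lam \<in> Lambda" for lam
  proof (cases "lam \<in> insert (-1, 0) wavelet_level")
    case True
    from Fmass_bumpy[OF this] have "Fmass bumpy lam \<ge> 0" "ln (real n) * ln (ln (real n)) / real n \<le> Fmass bumpy lam"
      using assms(2) zero_le_power[of "2::real" i] by (auto elim: order_trans[rotated])
    then show ?thesis by simp
  next
    case False
    moreover have "0 \<le> Fmass bumpy lam"
      unfolding Fmass_def set_lebesgue_integral_def by (intro integral_nonneg_AE) (simp add: bumpy_bounds)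
    ultimately show ?thesis using beta_bumpy[OF that] by simp
  qed
  moreover have "\<bar>bumpy x\<bar> \<le> R" for x using bumpy_bounds[of x] assms(1) by auto
  ultimately show ?thesis
    using int int2 assms(1) bumpy_bounds by (simp add: Fclass_def)
qed

text \<open>The minimum is bounded by the variance \<open>1 / n\<close> at each of at most
  \<open>2 ^ i + 1\<close> indices; the separate \<open>1 / n\<close> in the oracle raises the count
  to \<open>2 ^ i + 2\<close>.\<close>

lemma oracle_bound_bumpy: "oracle_bound n bumpy \<le> ennreal ((2 ^ i + 2) / real n)"
proof -
  let ?g = "\<lambda>lam. ennreal (min ((beta bumpy lam)\<^sup>2) (V_lam n bumpy lam))"
  let ?S = "insert (-1, 0) wavelet_level"
  have "infsum ?g (Gamma n) = infsum ?g (Gamma n \<inter> ?S)"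
  proof (rule infsum_cong_neutral)
    fix lam assume "lam \<in> Gamma n - Gamma n \<inter> ?S"
    then have "beta bumpy lam = 0" by (auto simp: beta_bumpy Gamma_def)
    then show "?g lam = 0" by (simp add: ennreal_eq_0_iff)
  qed auto
  also have "\<dots> = (\<Sum>lam\<in>Gamma n \<inter> ?S. ?g lam)" by simp
  also have "\<dots> \<le> (\<Sum>lam\<in>?S. ?g lam)" by (intro sum_mono2) auto
  also have "\<dots> \<le> (\<Sum>lam\<in>?S. ennreal (1 / n))"
    by (intro sum_mono ennreal_leI) (simp add: V_lam_bumpy)
  also have "\<dots> = of_nat (2 ^ i + 1) * ennreal (1 / n)"
    by (simp only: sum_constant) (simp add: card_wavelet_level)
  also have "\<dots> = ennreal ((2 ^ i + 1) / n)"
    unfolding ennreal_of_nat_eq_real_of_nat by (subst ennreal_mult[symmetric]) (auto simp: add.commute)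
  finally have "oracle_bound n bumpy \<le> ennreal ((2 ^ i + 1) / n) + ennreal (1 / n)"
    unfolding oracle_bound_def by (intro add_right_mono)
  also have "\<dots> = ennreal ((2 ^ i + 2) / real n)"
    by (subst ennreal_plus[symmetric]) (auto simp: add_divide_distrib)
  finally show ?thesis .
qed

text \<open>Almost everywhere, the error is a finite Haar combination, whose squared norm is the sum of its
  squared coefficients; each killed coefficient at level \<open>i\<close> costs \<open>a\<^sup>2\<close>.\<close>

lemma loss_ge:
  "(\<Sum>lam\<in>wavelet_level. ennreal (a\<^sup>2) * killed \<gamma> n lam k x)
    \<le> (\<integral>\<^sup>+ y. ennreal ((f_tilde \<gamma> n k x y - bumpy y)\<^sup>2) \<partial>lborel)"
proof -
  define c where "c lam = (if \<bar>beta_hat n k x lam\<bar> \<ge> eta \<gamma> n k x lam then beta_hat n k x lam else 0)" for lam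
  define A where "A = {lam \<in> Gamma n. c lam \<noteq> 0}"
  define B where "B = insert (-1, 0) (A \<union> wavelet_level)"
  \<comment> \<open>These are the Haar coefficients of the error. A killed index of the level is
    outside \<open>A\<close>, so there \<open>d lam = - a\<close>.\<close>
  define d where "d lam = c lam * of_bool (lam \<in> A) - of_bool (lam = (-1, 0)) - a * of_bool (lam \<in> wavelet_level)" for lam
  have finA: "finite A" and ft: "f_tilde \<gamma> n k x y = (\<Sum>lam\<in>A. c lam * varphi lam y)" for y
    unfolding A_def c_def using f_tilde_finite_sum by auto
  have B: "finite B" "B \<subseteq> Lambda" using finA wavelet_level_subset by (auto simp: B_def A_def Gamma_def)
  let ?h = "\<lambda>lam mu y. d lam * d mu * (haar lam y * haar mu y)"
  have sq: "(\<Sum>lam\<in>B. d lam * haar lam y)\<^sup>2 = (\<Sum>lam\<in>B. \<Sum>mu\<in>B. ?h lam mu y)" for y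
    by (simp add: power2_eq_square sum_product mult_ac)
  have int: "integrable lborel (?h lam mu)" if "lam \<in> B" "mu \<in> B" for lam mu
    using that B(2) by (intro integrable_mult_right integrable_haar_mult) auto
  have int_sq: "integrable lborel (\<lambda>y. (\<Sum>lam\<in>B. d lam * haar lam y)\<^sup>2)"
    unfolding sq by (intro Bochner_Integration.integrable_sum int)
  have "(\<integral>y. (\<Sum>lam\<in>B. d lam * haar lam y)\<^sup>2 \<partial>lborel) = (\<Sum>lam\<in>B. \<integral>y. (\<Sum>mu\<in>B. ?h lam mu y) \<partial>lborel)"
    unfolding sq by (intro Bochner_Integration.integral_sum Bochner_Integration.integrable_sum int)
  also have "\<dots> = (\<Sum>lam\<in>B. \<Sum>mu\<in>B. integral\<^sup>L lborel (?h lam mu))"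
    by (intro sum.cong refl Bochner_Integration.integral_sum int)
  also have "\<dots> = (\<Sum>lam\<in>B. \<Sum>mu\<in>B. d lam * d mu * of_bool (lam = mu))"
    using B(2) by (intro sum.cong refl) (auto simp: haar_orthonormal subset_iff)
  also have "\<dots> = (\<Sum>lam\<in>B. (d lam)\<^sup>2)"
    using B(1) by (simp add: of_bool_def if_distrib power2_eq_square cong: if_cong sum.cong)
  finally have integral_sq: "(\<integral>y. (\<Sum>lam\<in>B. d lam * haar lam y)\<^sup>2 \<partial>lborel) = (\<Sum>lam\<in>B. (d lam)\<^sup>2)" .
  have "AE y in lborel. \<forall>lam\<in>B. varphi lam y = haar lam y"
    using B AE_varphi_eq_haar by (intro AE_finite_allI) auto
  then have ae: "AE y in lborel. f_tilde \<gamma> n k x y - bumpy y = (\<Sum>lam\<in>B. d lam * haar lam y)"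
  proof (rule eventually_mono)
    fix y assume y: "\<forall>lam\<in>B. varphi lam y = haar lam y"
    have "f_tilde \<gamma> n k x y = (\<Sum>lam\<in>B. c lam * of_bool (lam \<in> A) * haar lam y)"
      unfolding ft using y B(1) by (intro sum.mono_neutral_cong_left) (auto simp: B_def)
    moreover have "haar (-1, 0) y = (\<Sum>lam\<in>B. of_bool (lam = (-1, 0)) * haar lam y)"
      using B(1) by (subst sum.remove[of _ "(-1, 0)"]) (auto simp: B_def intro!: sum.neutral)
    moreover have "(\<Sum>lam\<in>wavelet_level. haar lam y) = (\<Sum>lam\<in>B. of_bool (lam \<in> wavelet_level) * haar lam y)"
      using B(1) by (intro sum.mono_neutral_cong_left) (auto simp: B_def)
    ultimately show "f_tilde \<gamma> n k x y - bumpy y = (\<Sum>lam\<in>B. d lam * haar lam y)"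
      by (simp add: bumpy_def d_def left_diff_distrib sum_subtractf sum_distrib_left mult.assoc)
  qed
  have "(\<Sum>lam\<in>wavelet_level. ennreal (a\<^sup>2) * killed \<gamma> n lam k x)
      \<le> (\<Sum>lam\<in>wavelet_level. ennreal ((d lam)\<^sup>2))"
  proof (rule sum_mono)
    fix lam assume "lam \<in> wavelet_level"
    moreover from this have "lam \<noteq> (-1, 0)" by auto
    moreover have "lam \<notin> A" if "\<bar>beta_hat n k x lam\<bar> < eta \<gamma> n k x lam"
      using that by (simp add: A_def c_def)
    ultimately show "ennreal (a\<^sup>2) * killed \<gamma> n lam k x \<le> ennreal ((d lam)\<^sup>2)"
      by (cases "\<bar>beta_hat n k x lam\<bar> < eta \<gamma> n k x lam") (auto simp: d_def killed_def)
  qed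
  also have "\<dots> \<le> (\<Sum>lam\<in>B. ennreal ((d lam)\<^sup>2))"
    using B(1) by (intro sum_mono2) (auto simp: B_def)
  also have "\<dots> = ennreal (\<integral>y. (\<Sum>lam\<in>B. d lam * haar lam y)\<^sup>2 \<partial>lborel)"
    by (simp add: integral_sq)
  also have "\<dots> = (\<integral>\<^sup>+ y. ennreal ((\<Sum>lam\<in>B. d lam * haar lam y)\<^sup>2) \<partial>lborel)"
    by (intro nn_integral_eq_integral[symmetric] int_sq) auto
  also have "\<dots> = (\<integral>\<^sup>+ y. ennreal ((f_tilde \<gamma> n k x y - bumpy y)\<^sup>2) \<partial>lborel)"
    using ae by (intro nn_integral_cong_AE) (auto elim!: eventually_mono)
  finally show ?thesis .
qed

section \<open>Exponential moments under the perturbed intensity\<close>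

lemma measurable_killed:
  "killed \<gamma> n lam k \<in> borel_measurable (PiM {..<k} (\<lambda>_. lborel))"
  unfolding killed_def[abs_def] of_bool_def beta_hat_def eta_def V_tilde_def V_hat_def by measurable

text \<open>A function of \<open>varphi lam\<close> vanishing at 0 sees only three values and is
  thus a quadratic without constant term. Its integral against \<open>bumpy\<close> follows from
  \<open>\<integral> varphi\<^sup>2 f = 1\<close> and
  \<open>\<integral> varphi f = a\<close>.\<close>

lemma poisson_expect_exp_quadratic:
  assumes lam: "lam \<in> wavelet_level" and [measurable]: "g \<in> borel_measurable borel"
    and g: "\<And>x. exp (g x) - 1 = p * (varphi lam x)\<^sup>2 + q * varphi lam x"
  shows "poisson_expect n bumpy (\<lambda>k x. ennreal (exp (\<Sum>l<k. g (x l)))) = ennreal (exp (real n * (p + q * a)))"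
proof -
  have L: "lam \<in> Lambda" using lam wavelet_level_subset by auto
  have "lam \<noteq> (-1, 0)" using lam by auto
  then have "has_bochner_integral lborel (\<lambda>x. haar lam x * bumpy x) a"
    using integrable_haar_bumpy[OF L] integral_haar_bumpy[OF L] lam by (simp add: has_bochner_integral_iff)
  then have "has_bochner_integral lborel (\<lambda>x. p * ((haar lam x)\<^sup>2 * bumpy x) + q * (haar lam x * bumpy x)) (p * 1 + q * a)"
    by (intro has_bochner_integral_add has_bochner_integral_mult_right haar_squared_bumpy_has_integral lam)
  also have "?this \<longleftrightarrow> has_bochner_integral lborel (\<lambda>x. (exp (g x) - 1) * bumpy x) (p * 1 + q * a)"
    using AE_varphi_eq_haar[OF L]
    by (intro has_bochner_integral_cong_AE) (auto simp: g algebra_simps elim!: eventually_mono)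
  finally show ?thesis
    using poisson_expect_exp_sum[of bumpy g n] bumpy_bounds(1) bumpy_has_integral
    by (simp add: has_bochner_integral_iff)
qed

lemma varphi_cases:
  assumes "lam \<in> wavelet_level"
  shows "varphi lam x \<in> {- sqrt (2 ^ i), 0, sqrt (2 ^ i)}"
proof -
  have "2 powr (real i / 2) = sqrt (2 powr real i)"
    by (simp add: powr_half_sqrt[symmetric] powr_powr)
  then have "2 powr (real i / 2) = sqrt (2 ^ i)" by (simp add: powr_realpow)
  then show ?thesis using assms by (auto simp: wavelet_level_def varphi_def haar_psi_def indicator_def)
qed

subsection \<open>Chernoff bounds for the thresholding event\<close>

lemma poisson_expect_exp_varphi:
  assumes lam: "lam \<in> wavelet_level" and u: "\<bar>u\<bar> \<le> 1"
  shows "poisson_expect n bumpy (\<lambda>k x. ennreal (exp (\<Sum>l<k. u * varphi lam (x l) / sqrt (2 ^ i))))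
    \<le> ennreal (exp (n / 2 ^ i * (u\<^sup>2 + a * sqrt (2 ^ i) * u)))"
proof -
  define b where "b = a * sqrt (2 ^ i)"
  \<comment> \<open>\<open>p\<close> and \<open>q\<close> come from \<open>cosh u - 1\<close> and
    \<open>sinh u\<close>: they interpolate the exponential at the three values of
    \<open>varphi lam\<close>.\<close>
  define p where "p = ((exp u + exp (- u)) / 2 - 1) / 2 ^ i"
  define q where "q = (exp u - exp (- u)) / 2 / sqrt (2 ^ i)"
  have b: "0 \<le> b" "b \<le> 1" using a_nonneg a_le by (auto simp: b_def)
  have sq: "sqrt (2 ^ i) * sqrt (2 ^ i) = (2 ^ i :: real)" by simp
  have "exp (u * varphi lam x / sqrt (2 ^ i)) - 1 = p * (varphi lam x)\<^sup>2 + q * varphi lam x" for x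
    using varphi_cases[OF lam, of x] by (auto simp: p_def q_def field_simps)
  then have "poisson_expect n bumpy (\<lambda>k x. ennreal (exp (\<Sum>l<k. u * varphi lam (x l) / sqrt (2 ^ i))))
      = ennreal (exp (real n * (p + q * a)))"
    by (intro poisson_expect_exp_quadratic[OF lam]) auto
  moreover have "real n * (p + q * a) \<le> n / 2 ^ i * (u\<^sup>2 + b * u)"
  proof -
    have "q * a = (exp u - exp (- u)) / 2 * b / 2 ^ i"
      unfolding q_def b_def using sq by (simp add: field_simps)
    \<comment> \<open>Regrouping gives both exponentials nonnegative weights, since
      \<open>0 \<le> b \<le> 1\<close>, so the quadratic upper bound applies to each.\<close>
    then have "p + q * a = ((1 + b) * (exp u - 1) + (1 - b) * (exp (- u) - 1)) / 2 / 2 ^ i"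
      unfolding p_def by (simp add: field_simps)
    also have "\<dots> \<le> ((1 + b) * (u + u\<^sup>2) + (1 - b) * (- u + u\<^sup>2)) / 2 / 2 ^ i"
      using b exp_le_quadratic[of u] exp_le_quadratic[of "- u"] u
      by (intro divide_right_mono add_mono mult_left_mono) auto
    also have "\<dots> = (u\<^sup>2 + b * u) / 2 ^ i" by (simp add: field_simps)
    finally show ?thesis using mult_left_mono[of _ _ "real n"] by fastforce
  qed
  ultimately show ?thesis by (simp add: b_def ennreal_leI)
qed

text \<open>Here the sum of squares over \<open>2 ^ i\<close> counts the points in one support, a
  Poisson variable of mean \<open>n / 2 ^ i\<close>. The negative exponent controls its lower tail,
  hence that of the empirical variance.\<close>

lemma poisson_expect_exp_varphi_squared:
  assumes lam: "lam \<in> wavelet_level" and w: "0 \<le> w" "w \<le> 1"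
  shows "poisson_expect n bumpy (\<lambda>k x. ennreal (exp (\<Sum>l<k. - w * (varphi lam (x l))\<^sup>2 / 2 ^ i)))
    \<le> ennreal (exp (n / 2 ^ i * (w\<^sup>2 - w)))"
proof -
  define p where "p = (exp (- w) - 1) / 2 ^ i"
  have "exp (- w * (varphi lam x)\<^sup>2 / 2 ^ i) - 1 = p * (varphi lam x)\<^sup>2 + 0 * varphi lam x" for x
    using varphi_cases[OF lam, of x] by (auto simp: p_def)
  then have "poisson_expect n bumpy (\<lambda>k x. ennreal (exp (\<Sum>l<k. - w * (varphi lam (x l))\<^sup>2 / 2 ^ i)))
      = ennreal (exp (real n * (p + 0 * a)))"
    by (intro poisson_expect_exp_quadratic[OF lam]) auto
  moreover have "real n * p \<le> n / 2 ^ i * (w\<^sup>2 - w)"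
  proof -
    have "p \<le> (w\<^sup>2 - w) / 2 ^ i"
      unfolding p_def using exp_le_quadratic[of "- w"] w by (intro divide_right_mono) auto
    then show ?thesis using mult_left_mono[of p _ "real n"] by fastforce
  qed
  ultimately show ?thesis by (simp add: ennreal_leI)
qed

text \<open>In normalised sums, \<open>beta_hat\<close> is \<open>sqrt M / n * D\<close> and
  \<open>V_hat\<close> is \<open>M / n\<^sup>2\<close> times the count. The common factor
  \<open>sqrt M / n\<close> cancels when the coefficient is compared with the main term of the
  threshold.\<close>

lemma not_killed_imp:
  assumes "\<gamma> > 0" "n \<ge> 2" "killed \<gamma> n lam k x \<noteq> 1"
    and S: "(1 - \<delta>) * (n / 2 ^ i) \<le> (\<Sum>l<k. (varphi lam (x l))\<^sup>2 / 2 ^ i)"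
  shows "sqrt (2 * \<gamma> * (1 - \<delta>) * ln n * (n / 2 ^ i)) \<le> \<bar>\<Sum>l<k. varphi lam (x l) / sqrt (2 ^ i)\<bar>"
proof -
  define D where "D = (\<Sum>l<k. varphi lam (x l) / sqrt (2 ^ i))"
  define M :: real where "M = 2 ^ i"
  have M: "M > 0" by (simp add: M_def)
  have n: "real n > 0" "ln (real n) > 0" using assms(2) by auto
  have bh: "beta_hat n k x lam = sqrt M / n * D"
    by (simp add: beta_hat_def D_def M_def sum_divide_distrib[symmetric])
  have V: "V_hat n k x lam \<ge> (1 - \<delta>) * M / n\<^sup>2 * (n / M)"
  proof -
    have "V_hat n k x lam = M / n\<^sup>2 * (\<Sum>l<k. (varphi lam (x l))\<^sup>2 / M)"
      using M by (simp add: V_hat_def sum_divide_distrib[symmetric])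
    moreover have "M / n\<^sup>2 * ((1 - \<delta>) * (n / M)) \<le> M / n\<^sup>2 * (\<Sum>l<k. (varphi lam (x l))\<^sup>2 / M)"
      using S M by (intro mult_left_mono) (auto simp: M_def)
    ultimately show ?thesis using M by (simp add: mult_ac)
  qed
  have "sqrt M / n * sqrt (2 * \<gamma> * (1 - \<delta>) * ln n * (n / M))
      = sqrt (2 * \<gamma> * ((1 - \<delta>) * M / n\<^sup>2 * (n / M)) * ln n)"
  proof -
    have "sqrt M / n = sqrt (M / n\<^sup>2)" using n by (simp add: real_sqrt_divide)
    then show ?thesis by (simp only: real_sqrt_mult[symmetric]) (simp add: mult_ac)
  qed
  also have "\<dots> \<le> sqrt (2 * \<gamma> * V_hat n k x lam * ln n)"
    using V assms(1) n by (intro real_sqrt_le_mono mult_right_mono mult_left_mono) auto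
  also have "\<dots> \<le> eta \<gamma> n k x lam"
    using assms(1,2) by (intro eta_ge) auto
  also have "\<dots> \<le> \<bar>beta_hat n k x lam\<bar>"
    using assms(3) by (simp add: killed_def split: if_splits)
  also have "\<dots> = sqrt M / n * \<bar>D\<bar>" using n M by (simp add: bh abs_mult)
  finally have "sqrt (2 * \<gamma> * (1 - \<delta>) * ln n * (n / M)) \<le> \<bar>D\<bar>"
    by (rule mult_left_le_imp_le) (use n M in simp)
  then show ?thesis unfolding D_def M_def .
qed

text \<open>Survival forces one of three rare events: too few points in the support, or a large
  positive or negative normalised coefficient. Each is bounded by an exponential moment, and the
  three bounds are added.\<close>

lemma poisson_expect_killed:
  fixes u \<delta> \<gamma> :: real
  assumes "\<gamma> > 0" "n \<ge> 2" "0 < \<delta>" "\<delta> < 1" "0 \<le> u" "u \<le> 1" "lam \<in> wavelet_level"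
  defines "s \<equiv> n / 2 ^ i"
  shows "ennreal (1 - 2 * exp (s * (u\<^sup>2 + a * sqrt (2 ^ i) * u) - u * sqrt (2 * \<gamma> * (1 - \<delta>) * ln n * s))
      - exp (- (s * \<delta>\<^sup>2 / 4))) \<le> poisson_expect n bumpy (killed \<gamma> n lam)"
proof -
  define d where "d = sqrt (2 * \<gamma> * (1 - \<delta>) * ln n * s)"
  define e where "e = exp (s * (u\<^sup>2 + a * sqrt (2 ^ i) * u) - u * d)"
  define T where "T v k x = ennreal (exp (\<Sum>l<k. v * varphi lam (x l) / sqrt (2 ^ i)))" for v k and x :: "nat \<Rightarrow> real"
  \<comment> \<open>The exponent \<open>w = \<delta> / 2\<close> minimises
    \<open>w\<^sup>2 - w + w * (1 - \<delta>)\<close>, with minimum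
    \<open>- \<delta>\<^sup>2 / 4\<close>.\<close>
  define U where "U k x = ennreal (exp (\<Sum>l<k. - (\<delta> / 2) * (varphi lam (x l))\<^sup>2 / 2 ^ i))" for k and x :: "nat \<Rightarrow> real"
  define z where "z = ennreal (exp (- u * d))"
  define z' where "z' = ennreal (exp (\<delta> / 2 * ((1 - \<delta>) * s)))"
  have s: "s \<ge> 0" by (simp add: s_def)
  have meas [measurable]: "T v k \<in> borel_measurable (PiM {..<k} (\<lambda>_. lborel))"
    "U k \<in> borel_measurable (PiM {..<k} (\<lambda>_. lborel))" for v k
    unfolding T_def[abs_def] U_def[abs_def] by measurable
  have one_le: "1 \<le> ennreal (exp p) * ennreal (exp q)" if "p + q \<ge> 0" for p q :: real
    using that by (simp add: ennreal_mult[symmetric] exp_add[symmetric])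
  \<comment> \<open>This is the union bound in pointwise form: on each bad event the matching
    exponential is at least 1.\<close>
  have pw: "1 \<le> killed \<gamma> n lam k x + (z * T u k x + (z * T (- u) k x + z' * U k x))" for k x
  proof (cases "killed \<gamma> n lam k x = 1")
    case True
    then show ?thesis by (simp add: le_iff_add)
  next
    case nk: False
    define D where "D = (\<Sum>l<k. varphi lam (x l) / sqrt (2 ^ i))"
    define S where "S = (\<Sum>l<k. (varphi lam (x l))\<^sup>2 / 2 ^ i)"
    have T: "T v k x = ennreal (exp (v * D))" for v
      by (simp add: T_def D_def sum_distrib_left)
    have U: "U k x = ennreal (exp (- (\<delta> / 2) * S))"
      by (simp add: U_def S_def sum_distrib_left sum_negf)
    consider "S < (1 - \<delta>) * s" | "d \<le> D" | "d \<le> - D"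
      using not_killed_imp[OF assms(1,2) nk, of \<delta>] unfolding D_def S_def d_def s_def by linarith
    then show ?thesis
    proof cases
      case 1
      have "1 \<le> z' * U k x" unfolding z'_def U
        using mult_left_mono[of S "(1 - \<delta>) * s" "\<delta> / 2"] 1 assms(3) by (intro one_le) auto
      then show ?thesis by (meson add_increasing zero_le)
    next
      case 2
      have "1 \<le> z * T u k x" unfolding z_def T
        using mult_left_mono[OF 2 assms(5)] by (intro one_le) auto
      then show ?thesis by (meson add_increasing add_increasing2 zero_le)
    next
      case 3
      have "1 \<le> z * T (- u) k x" unfolding z_def T
        using mult_left_mono[OF 3 assms(5)] by (intro one_le) auto
      then show ?thesis by (meson add_increasing add_increasing2 zero_le)
    qed
  qed
  \<comment> \<open>Used for \<open>v = u\<close> and \<open>v = - u\<close>: as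
    \<open>a \<ge> 0\<close>, the drift only lowers the bound in the second case.\<close>
  have zT: "z * poisson_expect n bumpy (T v) \<le> ennreal e" if "\<bar>v\<bar> \<le> 1" "v \<le> u" "v\<^sup>2 = u\<^sup>2" for v
  proof -
    have "z * poisson_expect n bumpy (T v) \<le> z * ennreal (exp (s * (v\<^sup>2 + a * sqrt (2 ^ i) * v)))"
      using poisson_expect_exp_varphi[OF assms(7) that(1), of n] unfolding T_def s_def
      by (intro mult_left_mono) auto
    also have "\<dots> = ennreal (exp (s * (v\<^sup>2 + a * sqrt (2 ^ i) * v) - u * d))"
      by (simp add: z_def ennreal_mult[symmetric] exp_add[symmetric])
    also have "\<dots> \<le> ennreal e" unfolding e_def that(3)
      using that(2) s a_nonneg by (intro ennreal_leI) (simp add: mult_left_mono)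
    finally show ?thesis .
  qed
  have z'U: "z' * poisson_expect n bumpy U \<le> ennreal (exp (- (s * \<delta>\<^sup>2 / 4)))"
  proof -
    have "z' * poisson_expect n bumpy U \<le> z' * ennreal (exp (s * ((\<delta> / 2)\<^sup>2 - \<delta> / 2)))"
      using poisson_expect_exp_varphi_squared[OF assms(7), of "\<delta> / 2" n] assms(3,4) unfolding U_def s_def
      by (intro mult_left_mono) auto
    also have "\<dots> = ennreal (exp (- (s * \<delta>\<^sup>2 / 4)))"
      by (simp add: z'_def ennreal_mult[symmetric] exp_add[symmetric]) (simp add: field_simps power2_eq_square)
    finally show ?thesis .
  qed
  have "1 = poisson_expect n bumpy (\<lambda>k x. 1)"
    using poisson_expect_1[of bumpy n] bumpy_bounds(1) bumpy_has_integral by (simp add: has_bochner_integral_iff)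
  also have "\<dots> \<le> poisson_expect n bumpy (\<lambda>k x. killed \<gamma> n lam k x + (z * T u k x + (z * T (- u) k x + z' * U k x)))"
    by (intro poisson_expect_mono pw)
  also have "\<dots> = poisson_expect n bumpy (killed \<gamma> n lam)
      + (z * poisson_expect n bumpy (T u) + (z * poisson_expect n bumpy (T (- u)) + z' * poisson_expect n bumpy U))"
    by (simp add: poisson_expect_add poisson_expect_cmult measurable_killed)
  also have "\<dots> \<le> poisson_expect n bumpy (killed \<gamma> n lam) + (ennreal e + (ennreal e + ennreal (exp (- (s * \<delta>\<^sup>2 / 4)))))"
    using assms(5,6) by (intro add_left_mono add_mono zT z'U) auto
  also have "ennreal e + (ennreal e + ennreal (exp (- (s * \<delta>\<^sup>2 / 4)))) = ennreal (2 * e + exp (- (s * \<delta>\<^sup>2 / 4)))"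
    by (simp add: ennreal_plus[symmetric] e_def del: ennreal_plus)
  finally have "ennreal 1 - ennreal (2 * e + exp (- (s * \<delta>\<^sup>2 / 4))) \<le> poisson_expect n bumpy (killed \<gamma> n lam)"
    by (simp add: ennreal_minus_le_iff add.commute)
  \<comment> \<open>Both sides truncate to 0 if the real difference is negative.\<close>
  also have "ennreal 1 - ennreal (2 * e + exp (- (s * \<delta>\<^sup>2 / 4))) = ennreal (1 - 2 * e - exp (- (s * \<delta>\<^sup>2 / 4)))"
    by (subst ennreal_minus) (auto simp: e_def algebra_simps)
  finally show ?thesis unfolding e_def d_def .
qed

text \<open>By linearity the \<open>2 ^ i\<close> indices each contribute at least
  \<open>a\<^sup>2 * p\<close> to the risk; the oracle bound \<open>(2 ^ i + 2) / n\<close> then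
  yields the quotient.\<close>

lemma risk_over_oracle_ge:
  assumes "\<And>lam. lam \<in> wavelet_level \<Longrightarrow> ennreal p \<le> poisson_expect n bumpy (killed \<gamma> n lam)" "0 \<le> p" "n \<ge> 1"
  shows "ennreal (2 ^ i / (2 ^ i + 2) * (n * a\<^sup>2) * p) \<le> risk \<gamma> n bumpy / oracle_bound n bumpy"
proof -
  have "ennreal (2 ^ i * (a\<^sup>2 * p)) = (\<Sum>lam\<in>wavelet_level. ennreal (a\<^sup>2) * ennreal p)"
    using assms(2) by (simp add: card_wavelet_level ennreal_mult ennreal_power[symmetric])
  also have "\<dots> \<le> (\<Sum>lam\<in>wavelet_level. ennreal (a\<^sup>2) * poisson_expect n bumpy (killed \<gamma> n lam))"
    by (intro sum_mono mult_left_mono assms(1)) auto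
  also have "\<dots> = (\<Sum>lam\<in>wavelet_level. poisson_expect n bumpy (\<lambda>k x. ennreal (a\<^sup>2) * killed \<gamma> n lam k x))"
    by (simp add: poisson_expect_cmult measurable_killed)
  also have "\<dots> = poisson_expect n bumpy (\<lambda>k x. \<Sum>lam\<in>wavelet_level. ennreal (a\<^sup>2) * killed \<gamma> n lam k x)"
    unfolding poisson_expect_def
    by (subst suminf_sum[OF summableI, symmetric])
       (simp add: sum_distrib_left sum_distrib_right nn_integral_sum borel_measurable_times_ennreal
         poisson_weight_measurable measurable_killed)
  also have "\<dots> \<le> risk \<gamma> n bumpy"
    unfolding risk_def by (intro poisson_expect_mono loss_ge)
  finally have r: "ennreal (2 ^ i * (a\<^sup>2 * p)) \<le> risk \<gamma> n bumpy" .
  have "2 ^ i / (2 ^ i + 2) * (n * a\<^sup>2) * p = 2 ^ i * (a\<^sup>2 * p) / ((2 ^ i + 2) / n)"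
    by simp
  then have "ennreal (2 ^ i / (2 ^ i + 2) * (n * a\<^sup>2) * p) = ennreal (2 ^ i * (a\<^sup>2 * p)) / ennreal ((2 ^ i + 2) / n)"
    using assms(2,3) by (subst divide_ennreal) (auto intro!: divide_pos_pos add_pos_pos)
  also have "\<dots> \<le> risk \<gamma> n bumpy / ennreal ((2 ^ i + 2) / n)"
    by (rule divide_right_mono_ennreal[OF r])
  also have "\<dots> \<le> risk \<gamma> n bumpy / oracle_bound n bumpy"
    unfolding divide_ennreal_def
    by (intro mult_left_mono ennreal_inverse_antimono oracle_bound_bumpy) auto
  finally show ?thesis .
qed

end

section \<open>The lower bound\<close>

text \<open>At this scale there are enough coefficients for \<open>2 ^ i / (2 ^ i + 2)\<close> to
  tend to 1, while each support still expects at least \<open>sqrt n\<close> points, far more than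
  \<open>ln n\<close>.\<close>

lemma dyadic_scale_near_sqrt:
  assumes "n \<ge> 1"
  shows "\<exists>i. sqrt (real n) / 2 \<le> 2 ^ i \<and> 2 ^ i \<le> sqrt (real n)"
proof -
  define m where "m = nat \<lfloor>sqrt (real n)\<rfloor>"
  have "sqrt (real n) \<ge> 1" using assms by simp
  then have m: "m \<ge> 1" "real m \<le> sqrt (real n)" "sqrt (real n) < real (m + 1)"
    unfolding m_def by linarith+
  obtain i where i: "2 ^ i \<le> m" "m < 2 ^ (i + 1)"
    using ex_power_ivl1[of 2 m] m(1) by auto
  have "real (2 ^ i) \<le> real m" "real (m + 1) \<le> real (2 ^ (i + 1))"
    unfolding of_nat_le_iff using i by auto
  then have "2 ^ i \<le> real m" "real m + 1 \<le> 2 * 2 ^ i"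
    by simp_all
  moreover have "sqrt (real n) < real m + 1" using m(3) by simp
  ultimately show ?thesis using m(2) by (intro exI[of _ i] conjI) linarith+
qed

text \<open>With \<open>y\<close> the fourth root of \<open>n\<close>,
  \<open>ln n = 4 * ln y\<close> is eventually at most \<open>y\<close>; squaring gives the claim.
  It supplies all the growth conditions on \<open>n\<close> at once.\<close>

lemma eventually_ln_squared_le_sqrt:
  "\<forall>\<^sub>F n in sequentially. (ln (real n))\<^sup>2 \<le> sqrt (real n)"
proof -
  define y where "y n = sqrt (sqrt (real n))" for n :: nat
  have "filterlim y at_top sequentially"
    unfolding y_def by (intro filterlim_compose[OF sqrt_at_top] filterlim_real_sequentially)
  from filterlim_compose[OF ln_x_over_x_tendsto_0 this]
  have "\<forall>\<^sub>F n in sequentially. ln (y n) / y n < 1 / 4"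
    by (rule order_tendstoD) simp
  then show ?thesis using eventually_ge_at_top[of 1]
  proof eventually_elim
    case (elim n)
    then have "y n > 0" "(y n)\<^sup>2 = sqrt (real n)" by (auto simp: y_def)
    moreover have "ln (real n) = 4 * ln (y n)" using elim by (simp add: y_def ln_sqrt)
    ultimately have "ln (real n) \<le> y n" using elim by (simp add: field_simps)
    then have "(ln (real n))\<^sup>2 \<le> (y n)\<^sup>2" using elim by (intro power_mono) auto
    then show ?case using \<open>(y n)\<^sup>2 = sqrt (real n)\<close> by simp
  qed
qed

theorem theorem4:
  fixes \<gamma>min \<gamma> R :: real
  assumes "\<gamma>min > 1" and "\<gamma> > \<gamma>min" and "R \<ge> 2"
  shows "\<exists>\<epsilon>::nat \<Rightarrow> real. \<epsilon> \<longlonglongrightarrow> 0 \<and>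
    (\<forall>n\<ge>2. (SUP f\<in>Fclass n R. risk \<gamma> n f / oracle_bound n f)
        \<ge> ennreal (2 * (sqrt \<gamma> - sqrt \<gamma>min)\<^sup>2 * ln (real n) * (1 + \<epsilon> n)))"
proof -
  \<comment> \<open>\<open>\<kappa>\<close> lies strictly between \<open>r\<close> and \<open>sqrt \<gamma>\<close>: the signal sits at \<open>r\<close>, the threshold at \<open>sqrt \<gamma>\<close>, and
    \<open>\<delta>\<close> is the relative error in the empirical variance that lowers the threshold to \<open>\<kappa>\<close> only.\<close>
  define r where "r = sqrt \<gamma> - sqrt \<gamma>min"
  define \<kappa> where "\<kappa> = (r + sqrt \<gamma>) / 2"
  define \<delta> where "\<delta> = 1 - \<kappa>\<^sup>2 / \<gamma>"
  define v where "v = (\<kappa> - r) / sqrt 2"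
  have \<gamma>: "\<gamma> > 0" using assms by simp
  have "sqrt \<gamma>min > 0" using assms by simp
  moreover have r: "r > 0" using assms by (simp add: r_def)
  moreover have "sqrt \<gamma> = r + sqrt \<gamma>min" by (simp add: r_def)
  ultimately have \<kappa>: "r < \<kappa>" "0 < \<kappa>" "\<kappa> < sqrt \<gamma>" by (auto simp: \<kappa>_def add_pos_pos)
  have "\<kappa>\<^sup>2 < \<gamma>" using \<kappa> \<gamma> power_strict_mono[of \<kappa> "sqrt \<gamma>" 2] by simp
  then have \<delta>: "0 < \<delta>" "\<delta> < 1" using \<gamma> \<kappa> by (auto simp: \<delta>_def)
  have v: "v > 0" using \<kappa> by (simp add: v_def)
  \<comment> \<open>\<open>v\<close> minimises \<open>v\<^sup>2 - v * sqrt 2 * (\<kappa> - r)\<close>, the exponent of the Chernoff bound in units of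
    \<open>ln n\<close>; its minimum is \<open>- e1\<close>.\<close>
  define e1 where "e1 = (\<kappa> - r)\<^sup>2 / 2"
  define e2 where "e2 = \<delta>\<^sup>2 / 4"
  have e: "e1 > 0" "e2 > 0" using \<kappa> \<delta> by (auto simp: e1_def e2_def)
  \<comment> \<open>A lower bound for the probability of killing one coefficient: \<open>e1\<close>
    is the Chernoff exponent of the coefficient, \<open>e2\<close> that of the count.\<close>
  define P where "P n = 1 - 2 * exp (- (e1 * ln (real n))) - exp (- (e2 * sqrt (real n)))" for n :: nat
  \<comment> \<open>The fraction is \<open>2 ^ i / (2 ^ i + 2)\<close> at the smallest allowed value
    \<open>2 ^ i = sqrt n / 2\<close>.\<close>
  define \<epsilon>0 where "\<epsilon>0 n = sqrt (real n) / (sqrt (real n) + 4) * P n - 1" for n :: nat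
  \<comment> \<open>After \<open>n \<ge> 2\<close>, the conditions give in turn
    \<open>a * sqrt (2 ^ i) \<le> 1\<close>, \<open>u \<le> 1\<close>, membership in
    \<open>Fclass\<close>, and a nonnegative probability bound.\<close>
  define good where "good n \<longleftrightarrow> n \<ge> 2 \<and> r\<^sup>2 * 2 * ln (real n) \<le> sqrt (real n)
    \<and> v\<^sup>2 * ln (real n) \<le> sqrt (real n) \<and> ln (real n) * ln (ln (real n)) \<le> sqrt (real n) \<and> 0 \<le> P n" for n :: nat
  \<comment> \<open>The value \<open>-1\<close> makes the claimed bound 0 at the finitely many
    remaining \<open>n\<close>.\<close>
  define \<epsilon> where "\<epsilon> n = (if good n then \<epsilon>0 n else -1)" for n
  have ln_top: "filterlim (\<lambda>n::nat. ln (real n)) at_top sequentially"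
    by (rule filterlim_compose[OF ln_at_top filterlim_real_sequentially])
  have sqrt_top: "filterlim (\<lambda>n::nat. sqrt (real n)) at_top sequentially"
    by (rule filterlim_compose[OF sqrt_at_top filterlim_real_sequentially])
  have exp_lim: "(\<lambda>n. exp (- (c * g n))) \<longlonglongrightarrow> 0"
    if "c > 0" "filterlim g at_top sequentially" for c :: real and g :: "nat \<Rightarrow> real"
    by (intro filterlim_compose[OF exp_at_bot] filterlim_uminus_at_top[THEN iffD1]
        filterlim_tendsto_pos_mult_at_top[OF tendsto_const] that)
  have "P \<longlonglongrightarrow> 1 - 2 * 0 - 0"
    unfolding P_def by (intro tendsto_intros exp_lim e ln_top sqrt_top)
  then have P_lim: "P \<longlonglongrightarrow> 1" by simp
  have "(\<lambda>n::nat. 4 / (4 + sqrt (real n))) \<longlonglongrightarrow> 0"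
    by (intro tendsto_divide_0[OF tendsto_const] filterlim_at_top_imp_at_infinity
        filterlim_tendsto_add_at_top[OF tendsto_const sqrt_top])
  then have "(\<lambda>n::nat. 1 - 4 / (4 + sqrt (real n))) \<longlonglongrightarrow> 1 - 0"
    by (intro tendsto_intros)
  moreover have "1 - 4 / (4 + sqrt (real n)) = sqrt (real n) / (sqrt (real n) + 4)" for n :: nat
    using add_nonneg_pos[of "sqrt (real n)" 4] by (simp add: field_simps)
  ultimately have "(\<lambda>n::nat. sqrt (real n) / (sqrt (real n) + 4)) \<longlonglongrightarrow> 1" by simp
  from tendsto_diff[OF tendsto_mult[OF this P_lim] tendsto_const[of 1]] have \<epsilon>0_lim: "\<epsilon>0 \<longlonglongrightarrow> 0"
    by (simp add: \<epsilon>0_def[abs_def])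
  have "\<forall>\<^sub>F n in sequentially. 0 < P n"
    using order_tendstoD(1)[OF P_lim, of 0] by simp
  moreover have "\<forall>\<^sub>F n::nat in sequentially. max (max (r\<^sup>2 * 2) (v\<^sup>2)) 1 \<le> ln (real n)"
    using ln_top unfolding filterlim_at_top by blast
  ultimately have "eventually good sequentially"
    using eventually_ln_squared_le_sqrt eventually_ge_at_top[of 2]
  proof eventually_elim
    case (elim n)
    have bound: "c * ln (real n) \<le> sqrt (real n)" if "c \<le> ln (real n)" for c
    proof -
      have "c * ln (real n) \<le> (ln (real n))\<^sup>2"
        unfolding power2_eq_square using that elim by (intro mult_right_mono) auto
      with elim show ?thesis by linarith
    qed
    have "ln (ln (real n)) \<le> ln (real n)"
      using elim by (intro ln_bound) auto
    from bound[of "r\<^sup>2 * 2"] bound[of "v\<^sup>2"] bound[OF this] show ?case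
      using elim by (simp add: good_def mult.commute[of "ln (real n)"])
  qed
  then have "eventually (\<lambda>n. \<epsilon>0 n = \<epsilon> n) sequentially"
    by (rule eventually_mono) (simp add: \<epsilon>_def)
  with \<epsilon>0_lim have lim: "\<epsilon> \<longlonglongrightarrow> 0" by (rule Lim_transform_eventually)
  have "ennreal (2 * r\<^sup>2 * ln (real n) * (1 + \<epsilon> n)) \<le> (SUP f\<in>Fclass n R. risk \<gamma> n f / oracle_bound n f)" for n
  proof (cases "good n")
    case False
    then show ?thesis by (simp add: \<epsilon>_def)
  next
    case True
    then have n: "n \<ge> 2" by (simp add: good_def)
    define L where "L = ln (real n)"
    have L: "L > 0" using n by (simp add: L_def)
    obtain i where i: "sqrt (real n) / 2 \<le> 2 ^ i" "2 ^ i \<le> sqrt (real n)"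
      using dyadic_scale_near_sqrt[of n] n by auto
    define s where "s = real n / 2 ^ i"
    \<comment> \<open>\<open>w\<close> is the natural unit: the normalised signal
      \<open>a * sqrt (2 ^ i)\<close>, the threshold divided by \<open>s\<close>, and the Chernoff
      parameter \<open>u\<close> are all constant multiples of it.\<close>
    define w where "w = sqrt (L / s)"
    define a where "a = r * sqrt 2 * w / sqrt (2 ^ i)"
    define u where "u = v * w"
    have "sqrt (real n) * 2 ^ i \<le> sqrt (real n) * sqrt (real n)" using i by (intro mult_left_mono) auto
    then have s: "sqrt (real n) \<le> s" by (simp add: s_def field_simps)
    have s0: "s > 0" using n by (simp add: s_def)
    have w: "w \<ge> 0" "w\<^sup>2 = L / s" using L s0 by (auto simp: w_def)
    have aM: "a * sqrt (2 ^ i) = r * sqrt 2 * w" by (simp add: a_def)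
    have "(r * sqrt 2 * w)\<^sup>2 \<le> 1"
      using True s s0 by (auto simp: power_mult_distrib w good_def L_def)
    then have "r * sqrt 2 * w \<le> 1" by (simp add: abs_square_le_1 abs_le_iff)
    then have a: "0 \<le> a" "a * sqrt (2 ^ i) \<le> 1" using r w by (auto simp: a_def)
    let ?f = "bumpy i a"
    have "u\<^sup>2 \<le> 1"
      using True s s0 by (auto simp: power_mult_distrib w good_def L_def u_def)
    then have u: "0 \<le> u" "u \<le> 1" using v w by (auto simp: abs_square_le_1 abs_le_iff u_def)
    have "ln (real n) * ln (ln (real n)) \<le> s" using True s by (simp add: good_def)
    then have fF: "?f \<in> Fclass n R"
      using n assms(3) by (intro bumpy_in_Fclass[OF a]) (auto simp: s_def field_simps)
    have a2: "real n * a\<^sup>2 = 2 * r\<^sup>2 * L"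
      using n by (simp add: a_def power_mult_distrib power_divide w s_def)
    have "P n \<le> 1 - 2 * exp (s * (u\<^sup>2 + a * sqrt (2 ^ i) * u) - u * sqrt (2 * \<gamma> * (1 - \<delta>) * ln n * s))
      - exp (- (s * \<delta>\<^sup>2 / 4))"
    proof -
      \<comment> \<open>The choice of \<open>\<delta>\<close> puts the lowered threshold exactly at
        \<open>\<kappa>\<close>, so only the gap \<open>\<kappa> - r\<close> remains in the
        exponent.\<close>
      have "\<gamma> * (1 - \<delta>) = \<kappa>\<^sup>2" using \<gamma> by (simp add: \<delta>_def)
      then have "2 * \<gamma> * (1 - \<delta>) * ln n * s = (\<kappa> * sqrt 2 * w * s)\<^sup>2"
        using s0 by (simp add: power_mult_distrib w L_def power2_eq_square[of s])
      then have d: "sqrt (2 * \<gamma> * (1 - \<delta>) * ln n * s) = \<kappa> * sqrt 2 * w * s"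
        using \<kappa> w s0 by simp
      have "s * (u\<^sup>2 + a * sqrt (2 ^ i) * u) - u * sqrt (2 * \<gamma> * (1 - \<delta>) * ln n * s)
         = s * w\<^sup>2 * (v\<^sup>2 - v * sqrt 2 * (\<kappa> - r))"
        unfolding d aM u_def by (simp add: algebra_simps power2_eq_square)
      also have "v\<^sup>2 - v * sqrt 2 * (\<kappa> - r) = - e1"
        by (simp add: v_def e1_def power_divide power2_eq_square)
      also have "s * w\<^sup>2 * - e1 = - (e1 * ln (real n))"
        using s0 by (simp add: w L_def)
      finally have "s * (u\<^sup>2 + a * sqrt (2 ^ i) * u) - u * sqrt (2 * \<gamma> * (1 - \<delta>) * ln n * s)
         = - (e1 * ln (real n))" .
      moreover have "e2 * sqrt (real n) \<le> s * \<delta>\<^sup>2 / 4"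
        using mult_right_mono[OF s, of e2] e by (simp add: e2_def mult.commute)
      ultimately show ?thesis by (simp add: P_def)
    qed
    then have kill: "ennreal (P n) \<le> poisson_expect n ?f (killed \<gamma> n lam)" if "lam \<in> wavelet_level i" for lam
      using poisson_expect_killed[OF a \<gamma> n \<delta> u that] unfolding s_def
      by (meson ennreal_leI order_trans)
    have "sqrt (real n) / (sqrt (real n) + 4) \<le> 2 ^ i / (2 ^ i + 2)"
      using i(1) add_nonneg_pos[of "sqrt (real n)" 4] add_pos_pos[of "2 ^ i" "2 :: real"]
      by (simp add: pos_divide_le_eq pos_le_divide_eq field_simps)
    moreover have P0: "0 \<le> P n" using True by (simp add: good_def)
    ultimately have "1 + \<epsilon> n \<le> 2 ^ i / (2 ^ i + 2) * P n"
      using True mult_right_mono[of _ _ "P n"] by (simp add: \<epsilon>_def \<epsilon>0_def) fastforce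
    then have "2 * r\<^sup>2 * ln (real n) * (1 + \<epsilon> n) \<le> 2 * r\<^sup>2 * L * (2 ^ i / (2 ^ i + 2) * P n)"
      using L unfolding L_def[symmetric] by (intro mult_left_mono) auto
    also have "\<dots> = 2 ^ i / (2 ^ i + 2) * (real n * a\<^sup>2) * P n" by (simp add: a2)
    finally have "ennreal (2 * r\<^sup>2 * ln (real n) * (1 + \<epsilon> n)) \<le> risk \<gamma> n ?f / oracle_bound n ?f"
      using risk_over_oracle_ge[OF a kill P0] n by (meson ennreal_leI order_trans le_trans one_le_numeral)
    with fF show ?thesis by (meson SUP_upper2)
  qed
  with lim show ?thesis unfolding r_def by blast
qed

end
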